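(* Let $I=[-1,1]$ and let $\mathcal F=\{u_0,u_1,\dots,u_n\}$ be any family of real-valued continuous functions on $I$, with generalized moment morphism $\mathcal K_n$. Let $\varUpsilon$ be a Jordan support family and let $\sigma$ be a signed measure on $I$ whose Jordan support belongs to $\varUpsilon$. (a) If $\mathcal K_n$ satisfies the nullspace property with respect to $\varUpsilon$, then $\sigma$ is the unique solution of generalized minimal extrapolation given $\mathcal K_n(\sigma)$, i.e. the unique minimizer of $\|\mu\|_{TV}$ over all finite signed measures $\mu$ on $I$ with $\mathcal K_n(\mu)=\mathcal K_n(\sigma)$. (b) If $\mathcal K_n$ satisfies the weak nullspace property with respect to $\varUpsilon$, then $\sigma$ is a solution of generalized minimal extrapolation given $\mathcal K_n(\sigma)$, i.e. a minimizer of $\|\mu\|_{TV}$ over all finite signed measures $\mu$ on $I$ with $\mathcal K_n(\mu)=\mathcal K_n(\sigma)$.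
   Context: Let $\mathcal M$ be the space of finite signed (Borel) measures on $I$ and $\|\cdot\|_{TV}$ the total variation norm. The generalized moment morphism is the linear map $\mathcal K_n:\mathcal M\to\mathbb R^{n+1}$, $\mathcal K_n(\mu)=\big(\int_I u_0\,d\mu,\dots,\int_I u_n\,d\mu\big)$, with nullspace $\ker(\mathcal K_n)$. The Jordan support of $\sigma\in\mathcal M$ with Jordan decomposition $\sigma=\sigma^+-\sigma^-$ is the pair $(\mathrm{Supp}(\sigma^+),\mathrm{Supp}(\sigma^-))$. A Jordan support family $\varUpsilon$ is a family of pairs $(\mathcal S^+,\mathcal S^-)$ of finite subsets of $I$. For a finite set $S\subset I$ and $\mu\in\mathcal M$, write $\mu=\mu_S+\mu_{S^c}$ for the Lebesgue decomposition with respect to $\sum_{x\in S}\delta_x$: $\mu_S$ is the restriction of $\mu$ to $S$ (a discrete measure supported in $S$), and $\mu_{S^c}$ is the restriction of $\mu$ to $S^c=I\setminus S$. $\mathcal K_n$ satisfies the nullspace property with respect to $\varUpsilon$ if for all nonzero $\mu\in\ker(\mathcal K_n)$ and all $(\mathcal S^+,\mathcal S^-)\in\varUpsilon$, with $S=\mathcal S^+\cup\mathcal S^-$, one has $\|\mu_S\|_{TV}<\|\mu_{S^c}\|_{TV}$. It satisfies the weak nullspace property with respect to $\varUpsilon$ if the same holds with $\le$ in place of $<$. *)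

theory Defs
  imports "HOL-Analysis.Analysis"
begin

text \<open>
  A finite signed measure on the measurable space \<open>M\<close> is represented by its real-valued, countably
  additive set function, set to 0 outside \<open>sets M\<close> so that equality of signed measures is equality
  of functions. Only \<open>space M\<close> and \<open>sets M\<close> matter here, not the measure carried by \<open>M\<close>.
\<close>

definition signed_measures :: "'a measure \<Rightarrow> ('a set \<Rightarrow> real) set" where
  "signed_measures M = {\<mu>. \<mu> {} = 0 \<and>
     (\<forall>A :: nat \<Rightarrow> 'a set. range A \<subseteq> sets M \<longrightarrow> disjoint_family A \<longrightarrow>
        (\<lambda>i. \<mu> (A i)) sums \<mu> (\<Union>i. A i)) \<and>
     (\<forall>A. A \<notin> sets M \<longrightarrow> \<mu> A = 0)}"

text \<open>
  The supremum below is over a bounded set for every member of \<open>signed_measures M\<close>, so taking it in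
  the reals is meaningful.
\<close>

definition tv_norm :: "'a measure \<Rightarrow> ('a set \<Rightarrow> real) \<Rightarrow> real" where
  "tv_norm M \<mu> =
     (SUP \<E> \<in> {\<E>. finite \<E> \<and> \<E> \<subseteq> sets M \<and> partition_on (space M) \<E>}. \<Sum>E\<in>\<E>. \<bar>\<mu> E\<bar>)"

definition mutually_singular :: "'a measure \<Rightarrow> 'a measure \<Rightarrow> 'a measure \<Rightarrow> bool" where
  "mutually_singular M P N \<longleftrightarrow>
     (\<exists>X\<in>sets M. emeasure P (space M - X) = 0 \<and> emeasure N X = 0)"

definition is_jordan_decomposition ::
  "'a measure \<Rightarrow> ('a set \<Rightarrow> real) \<Rightarrow> 'a measure \<Rightarrow> 'a measure \<Rightarrow> bool" where
  "is_jordan_decomposition M \<mu> P N \<longleftrightarrow>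
     finite_measure P \<and> finite_measure N \<and> sets P = sets M \<and> sets N = sets M \<and>
     mutually_singular M P N \<and>
     (\<forall>A\<in>sets M. \<mu> A = measure P A - measure N A)"

text \<open>Existence and uniqueness for \<open>\<mu> \<in> signed_measures M\<close> is the Jordan decomposition theorem.\<close>

definition jordan_decomposition ::
  "'a measure \<Rightarrow> ('a set \<Rightarrow> real) \<Rightarrow> 'a measure \<times> 'a measure" where
  "jordan_decomposition M \<mu> = (THE (P, N). is_jordan_decomposition M \<mu> P N)"

definition jordan_pos :: "'a measure \<Rightarrow> ('a set \<Rightarrow> real) \<Rightarrow> 'a measure" where
  "jordan_pos M \<mu> = fst (jordan_decomposition M \<mu>)"

definition jordan_neg :: "'a measure \<Rightarrow> ('a set \<Rightarrow> real) \<Rightarrow> 'a measure" where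
  "jordan_neg M \<mu> = snd (jordan_decomposition M \<mu>)"

definition signed_integral :: "'a measure \<Rightarrow> ('a set \<Rightarrow> real) \<Rightarrow> ('a \<Rightarrow> real) \<Rightarrow> real" where
  "signed_integral M \<mu> f =
     integral\<^sup>L (jordan_pos M \<mu>) f - integral\<^sup>L (jordan_neg M \<mu>) f"

definition measure_support :: "'a::topological_space measure \<Rightarrow> 'a set" where
  "measure_support P = {x \<in> space P. \<forall>U. open U \<longrightarrow> x \<in> U \<longrightarrow> emeasure P (U \<inter> space P) > 0}"

definition jordan_support ::
  "'a::topological_space measure \<Rightarrow> ('a set \<Rightarrow> real) \<Rightarrow> 'a set \<times> 'a set" where
  "jordan_support M \<mu> = (measure_support (jordan_pos M \<mu>), measure_support (jordan_neg M \<mu>))"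

definition signed_restrict :: "'a measure \<Rightarrow> ('a set \<Rightarrow> real) \<Rightarrow> 'a set \<Rightarrow> 'a set \<Rightarrow> real" where
  "signed_restrict M \<mu> S = (\<lambda>A. if A \<in> sets M then \<mu> (A \<inter> S) else 0)"

abbreviation I_borel :: "real measure" where
  "I_borel \<equiv> restrict_space borel {-1..1}"

definition jordan_support_family :: "(real set \<times> real set) set \<Rightarrow> bool" where
  "jordan_support_family \<Upsilon> \<longleftrightarrow>
     (\<forall>(Sp, Sn)\<in>\<Upsilon>. finite Sp \<and> finite Sn \<and> Sp \<subseteq> {-1..1} \<and> Sn \<subseteq> {-1..1})"

text \<open>
  Vectors of \<open>\<real>\<^sup>n\<^sup>+\<^sup>1\<close> are functions on \<open>{..n}\<close>, extended by \<open>undefined\<close> to all of \<open>nat\<close>.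
\<close>

definition moment_map :: "(nat \<Rightarrow> real \<Rightarrow> real) \<Rightarrow> nat \<Rightarrow> (real set \<Rightarrow> real) \<Rightarrow> nat \<Rightarrow> real" where
  "moment_map u n \<mu> = (\<lambda>k\<in>{..n}. signed_integral I_borel \<mu> (u k))"

definition moment_kernel :: "(nat \<Rightarrow> real \<Rightarrow> real) \<Rightarrow> nat \<Rightarrow> (real set \<Rightarrow> real) set" where
  "moment_kernel u n = {\<mu> \<in> signed_measures I_borel. moment_map u n \<mu> = (\<lambda>k\<in>{..n}. 0)}"

definition nullspace_property ::
  "(nat \<Rightarrow> real \<Rightarrow> real) \<Rightarrow> nat \<Rightarrow> (real set \<times> real set) set \<Rightarrow> bool" where
  "nullspace_property u n \<Upsilon> \<longleftrightarrow>
     (\<forall>\<mu>\<in>moment_kernel u n. \<mu> \<noteq> (\<lambda>A. 0) \<longrightarrow>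
        (\<forall>(Sp, Sn)\<in>\<Upsilon>. let S = Sp \<union> Sn in
           tv_norm I_borel (signed_restrict I_borel \<mu> S)
             < tv_norm I_borel (signed_restrict I_borel \<mu> ({-1..1} - S))))"

definition weak_nullspace_property ::
  "(nat \<Rightarrow> real \<Rightarrow> real) \<Rightarrow> nat \<Rightarrow> (real set \<times> real set) set \<Rightarrow> bool" where
  "weak_nullspace_property u n \<Upsilon> \<longleftrightarrow>
     (\<forall>\<mu>\<in>moment_kernel u n. \<mu> \<noteq> (\<lambda>A. 0) \<longrightarrow>
        (\<forall>(Sp, Sn)\<in>\<Upsilon>. let S = Sp \<union> Sn in
           tv_norm I_borel (signed_restrict I_borel \<mu> S)
             \<le> tv_norm I_borel (signed_restrict I_borel \<mu> ({-1..1} - S))))"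

definition minimal_extrapolations ::
  "(nat \<Rightarrow> real \<Rightarrow> real) \<Rightarrow> nat \<Rightarrow> (nat \<Rightarrow> real) \<Rightarrow> (real set \<Rightarrow> real) set" where
  "minimal_extrapolations u n m =
     {\<mu> \<in> signed_measures I_borel. moment_map u n \<mu> = m \<and>
        (\<forall>\<nu>\<in>signed_measures I_borel. moment_map u n \<nu> = m \<longrightarrow> tv_norm I_borel \<mu> \<le> tv_norm I_borel \<nu>)}"

end

theory Submission imports Defs begin

text \<open>
  Let \<open>S\<close> be the union of the two parts of the Jordan support of \<open>\<sigma>\<close>, and \<open>T\<close> its complement.
  \<open>S\<close> carries all of \<open>\<sigma>\<close>, because in a second countable space the complement of the support of a
  measure is null. If \<open>\<nu>\<close> has the moments of \<open>\<sigma>\<close>, then \<open>\<mu> = \<nu> - \<sigma>\<close> lies in the kernel, and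
  \<open>\<parallel>\<nu>\<parallel> = \<parallel>\<nu>\<^sub>S\<parallel> + \<parallel>\<nu>\<^sub>T\<parallel> = \<parallel>\<sigma> + \<mu>\<^sub>S\<parallel> + \<parallel>\<mu>\<^sub>T\<parallel> \<ge> \<parallel>\<sigma>\<parallel> - \<parallel>\<mu>\<^sub>S\<parallel> + \<parallel>\<mu>\<^sub>T\<parallel>\<close>,
  so the nullspace property gives the claim. The total variation is additive over \<open>S\<close> and \<open>T\<close>
  because a Hahn set of \<open>\<nu>\<close> is one for both restrictions.
\<close>

section \<open>Signed measures\<close>

lemma signed_measuresI:
  assumes "\<mu> {} = 0" "\<And>A. A \<notin> sets M \<Longrightarrow> \<mu> A = 0"
    and "\<And>A :: nat \<Rightarrow> 'a set. range A \<subseteq> sets M \<Longrightarrow> disjoint_family A \<Longrightarrow>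
      (\<lambda>i. \<mu> (A i)) sums \<mu> (\<Union>i. A i)"
  shows "\<mu> \<in> signed_measures M"
  unfolding signed_measures_def mem_Collect_eq by (intro conjI allI impI assms)

lemma
  assumes "\<mu> \<in> signed_measures M"
  shows signed_measures_empty [simp]: "\<mu> {} = 0"
    and signed_measures_notin_sets: "A \<notin> sets M \<Longrightarrow> \<mu> A = 0"
  using assms by (simp_all add: signed_measures_def)

lemma signed_measures_sums:
  fixes A :: "nat \<Rightarrow> 'a set"
  assumes \<mu>: "\<mu> \<in> signed_measures M" and A: "range A \<subseteq> sets M" "disjoint_family A"
  shows "(\<lambda>i. \<mu> (A i)) sums \<mu> (\<Union>i. A i)"
proof -
  have "\<forall>A :: nat \<Rightarrow> 'a set. range A \<subseteq> sets M \<longrightarrow> disjoint_family A \<longrightarrow>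
      (\<lambda>i. \<mu> (A i)) sums \<mu> (\<Union>i. A i)"
    using \<mu> unfolding signed_measures_def by (elim CollectE conjE)
  from this[rule_format, OF A] show ?thesis .
qed

lemma signed_measures_Un:
  assumes \<mu>: "\<mu> \<in> signed_measures M" and AB: "A \<in> sets M" "B \<in> sets M" "A \<inter> B = {}"
  shows "\<mu> (A \<union> B) = \<mu> A + \<mu> B"
proof -
  have "(\<lambda>i. \<mu> (binaryset A B i)) sums \<mu> (\<Union>i. binaryset A B i)"
    using AB by (intro signed_measures_sums[OF \<mu>])
      (auto simp: range_binaryset_eq disjoint_family_on_def binaryset_def)
  moreover have "(\<lambda>i. \<mu> (binaryset A B i)) sums (\<mu> A + \<mu> B)"
    using \<mu> by (intro binaryset_sums) auto
  ultimately show ?thesis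
    using sums_unique2 UN_binaryset_eq by metis
qed

lemma signed_measures_Int_Diff:
  assumes "\<mu> \<in> signed_measures M" "A \<in> sets M" "X \<in> sets M"
  shows "\<mu> A = \<mu> (A \<inter> X) + \<mu> (A - X)"
proof -
  have "(A \<inter> X) \<union> (A - X) = A" "(A \<inter> X) \<inter> (A - X) = {}"
    by auto
  then show ?thesis
    using signed_measures_Un[OF assms(1), of "A \<inter> X" "A - X"] assms by auto
qed

lemma signed_measures_Union:
  assumes \<mu>: "\<mu> \<in> signed_measures M" and "finite \<E>" "\<E> \<subseteq> sets M" "disjoint \<E>"
  shows "\<mu> (\<Union>\<E>) = (\<Sum>E\<in>\<E>. \<mu> E)"
  using assms(2-)
proof (induction \<E>)
  case empty
  then show ?case using \<mu> by simp
next
  case (insert E \<E>)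
  have "E \<inter> \<Union>\<E> = {}"
    using insert.hyps(2) insert.prems(2) by (fastforce simp: disjoint_def)
  moreover have "\<Union>\<E> \<in> sets M"
    using insert by (intro sets.finite_Union) auto
  ultimately have "\<mu> (E \<union> \<Union>\<E>) = \<mu> E + \<mu> (\<Union>\<E>)"
    using insert.prems by (intro signed_measures_Un[OF \<mu>]) auto
  then show ?case
    using insert by (auto simp: disjoint_def)
qed

lemma signed_measures_uminus:
  assumes "\<mu> \<in> signed_measures M" shows "(\<lambda>A. - \<mu> A) \<in> signed_measures M"
  by (rule signed_measuresI)
    (use assms in \<open>simp_all add: signed_measures_notin_sets sums_minus signed_measures_sums\<close>)

lemma signed_measures_diff:
  assumes "\<mu> \<in> signed_measures M" "\<nu> \<in> signed_measures M"
  shows "(\<lambda>A. \<mu> A - \<nu> A) \<in> signed_measures M"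
  by (rule signed_measuresI)
    (use assms in \<open>simp_all add: signed_measures_notin_sets sums_diff signed_measures_sums\<close>)

lemma signed_restrict_signed_measures:
  assumes "\<mu> \<in> signed_measures M" "S \<in> sets M"
  shows "signed_restrict M \<mu> S \<in> signed_measures M"
proof (rule signed_measuresI)
  fix A :: "nat \<Rightarrow> 'a set"
  assume A: "range A \<subseteq> sets M" "disjoint_family A"
  have "(\<lambda>i. \<mu> (A i \<inter> S)) sums \<mu> (\<Union>i. A i \<inter> S)"
    using A assms(2) by (intro signed_measures_sums[OF assms(1)])
      (auto simp: disjoint_family_on_def)
  moreover have "(\<Union>i. A i \<inter> S) = (\<Union>i. A i) \<inter> S"
    by auto
  moreover have "A i \<in> sets M" for i
    using A by auto
  ultimately show "(\<lambda>i. signed_restrict M \<mu> S (A i)) sums signed_restrict M \<mu> S (\<Union>i. A i)"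
    by (auto simp: signed_restrict_def)
qed (use assms in \<open>simp_all add: signed_restrict_def\<close>)

section \<open>Hahn decomposition\<close>

text \<open>Each step takes a set whose measure is at least half the supremum (capped at \<open>1\<close>, as the
  supremum is not yet known to be finite) over the sets still available; the measures of these
  disjoint sets tend to \<open>0\<close>, so nothing of positive measure remains.\<close>

lemma greedy_exhaustion:
  assumes \<mu>: "\<mu> \<in> signed_measures M" and Q: "Q \<subseteq> sets M" "{} \<in> Q"
  obtains B :: "nat \<Rightarrow> 'a set" where "range B \<subseteq> Q" "disjoint_family B" "\<forall>i. 0 \<le> \<mu> (B i)"
    "\<forall>C\<in>Q. C \<inter> (\<Union>i. B i) = {} \<longrightarrow> \<mu> C \<le> 0"
proof -
  define good where "good U B \<longleftrightarrow> B \<in> Q \<and> B \<inter> U = {} \<and> 0 \<le> \<mu> B \<and>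
    (\<forall>C\<in>Q. C \<inter> U = {} \<longrightarrow> min 1 (\<mu> C) \<le> 2 * \<mu> B)" for U B
  have ex: "\<exists>B. good U B" for U
  proof -
    define Z where "Z = (\<lambda>C. min 1 (\<mu> C)) ` {C \<in> Q. C \<inter> U = {}}"
    have Z: "0 \<in> Z"
      using Q \<mu> by (auto simp: Z_def intro!: image_eqI[of _ _ "{}"])
    have bdd: "bdd_above Z"
      by (auto simp: Z_def intro!: bdd_aboveI[of _ 1])
    show ?thesis
    proof (cases "Sup Z \<le> 0")
      case True
      \<comment> \<open>Half of \<open>Sup Z\<close> lies below \<open>Sup Z\<close> only when the
        supremum is positive. Here no available set has positive measure, so the empty set already
        meets the requirement.\<close>
      then have "\<forall>z\<in>Z. z \<le> 0"
        using cSup_upper[OF _ bdd] by fastforce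
      then have "good U {}"
        using Q \<mu> by (auto simp: good_def Z_def)
      then show ?thesis ..
    next
      case False
      then have "Sup Z / 2 < Sup Z"
        by simp
      then obtain z where z: "z \<in> Z" "Sup Z / 2 < z"
        using less_cSup_iff[of Z] Z bdd by blast
      then obtain B where B: "B \<in> Q" "B \<inter> U = {}" "Sup Z / 2 < min 1 (\<mu> B)"
        unfolding Z_def by blast
      have "min 1 (\<mu> C) \<le> 2 * \<mu> B" if "C \<in> Q" "C \<inter> U = {}" for C
      proof -
        have "min 1 (\<mu> C) \<le> Sup Z"
          using that by (intro cSup_upper[OF _ bdd]) (auto simp: Z_def)
        then show ?thesis
          using B by linarith
      qed
      then have "good U B"
        using B False by (auto simp: good_def)
      then show ?thesis ..
    qed
  qed
  define next_set where "next_set U = (SOME B. good U B)" for U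
  have next_set: "good U (next_set U)" for U
    unfolding next_set_def using ex by (rule someI_ex)
  \<comment> \<open>The recursion keeps only the union of the sets taken so far, because
    \<open>good\<close> asks no more of the past than disjointness from it.\<close>
  define U where "U = rec_nat {} (\<lambda>_ V. V \<union> next_set V)"
  define B where "B i = next_set (U i)" for i
  have B: "good (U i) (B i)" for i
    by (simp add: B_def next_set)
  have USuc: "U (Suc i) = U i \<union> B i" for i
    by (simp add: U_def B_def)
  have U_UN: "U n = (\<Union>i<n. B i)" for n
  proof (induction n)
    case 0
    then show ?case by (simp add: U_def)
  next
    case (Suc n)
    then show ?case using USuc by (auto simp: lessThan_Suc)
  qed
  have disj: "disjoint_family B"
  proof -
    have "B i \<inter> B j = {}" if "i < j" for i j
      using B[of j] that U_UN[of j] by (auto simp: good_def)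
    then show ?thesis
      unfolding disjoint_family_on_def by (metis Int_commute linorder_neqE_nat)
  qed
  have range: "range B \<subseteq> Q"
    using B by (auto simp: good_def)
  have "(\<lambda>i. \<mu> (B i)) sums \<mu> (\<Union>i. B i)"
    using range Q disj by (intro signed_measures_sums[OF \<mu>]) auto
  then have lim: "(\<lambda>i. 2 * \<mu> (B i)) \<longlonglongrightarrow> 2 * 0"
    by (intro tendsto_intros summable_LIMSEQ_zero) (auto simp: sums_iff)
  show ?thesis
  proof (rule that[OF range disj])
    show "\<forall>i. 0 \<le> \<mu> (B i)"
      using B by (auto simp: good_def)
    show "\<forall>C\<in>Q. C \<inter> (\<Union>i. B i) = {} \<longrightarrow> \<mu> C \<le> 0"
    proof (intro ballI impI)
      fix C assume C: "C \<in> Q" "C \<inter> (\<Union>i. B i) = {}"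
      have "min 1 (\<mu> C) \<le> 2 * \<mu> (B i)" for i
      proof -
        have "C \<inter> U i = {}"
          using C(2) U_UN[of i] by auto
        then show ?thesis
          using B[of i] C(1) by (auto simp: good_def)
      qed
      \<comment> \<open>The left side does not depend on \<open>i\<close>, so it is at most the
        limit. Since the cap 1 is positive, it must be \<open>\<mu> C\<close> that is at most
        0.\<close>
      then have "min 1 (\<mu> C) \<le> 2 * 0"
        by (intro LIMSEQ_le_const[OF lim]) blast
      then show "\<mu> C \<le> 0"
        by auto
    qed
  qed
qed

text \<open>One set encodes a Hahn decomposition: \<open>X\<close> is the positive part, and the
  negative part is its complement in the space.\<close>

definition hahn_set :: "'a measure \<Rightarrow> ('a set \<Rightarrow> real) \<Rightarrow> 'a set \<Rightarrow> bool" where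
  "hahn_set M \<mu> X \<longleftrightarrow> X \<in> sets M \<and>
     (\<forall>A\<in>sets M. (A \<subseteq> X \<longrightarrow> 0 \<le> \<mu> A) \<and> (A \<inter> X = {} \<longrightarrow> \<mu> A \<le> 0))"

lemma hahn_set_Int_nonneg: "hahn_set M \<mu> X \<Longrightarrow> A \<in> sets M \<Longrightarrow> 0 \<le> \<mu> (A \<inter> X)"
proof -
  assume "hahn_set M \<mu> X" and A: "A \<in> sets M"
  then have X: "X \<in> sets M" "\<forall>B\<in>sets M. B \<subseteq> X \<longrightarrow> 0 \<le> \<mu> B"
    by (simp_all add: hahn_set_def)
  from X(2)[rule_format, OF sets.Int[OF A X(1)]] show ?thesis
    by simp
qed

lemma hahn_set_Diff_nonpos: "hahn_set M \<mu> X \<Longrightarrow> A \<in> sets M \<Longrightarrow> \<mu> (A - X) \<le> 0"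
proof -
  assume "hahn_set M \<mu> X" and A: "A \<in> sets M"
  then have X: "X \<in> sets M" "\<forall>B\<in>sets M. B \<inter> X = {} \<longrightarrow> \<mu> B \<le> 0"
    by (simp_all add: hahn_set_def)
  from X(2)[rule_format, OF sets.Diff[OF A X(1)]] show ?thesis
    by auto
qed

definition negative_set :: "'a measure \<Rightarrow> ('a set \<Rightarrow> real) \<Rightarrow> 'a set \<Rightarrow> bool" where
  "negative_set M \<mu> X \<longleftrightarrow> X \<in> sets M \<and> (\<forall>A\<in>sets M. A \<subseteq> X \<longrightarrow> \<mu> A \<le> 0)"

text \<open>Exhaust \<open>D\<close> by disjoint subsets of nonnegative measure and discard their
  union. What is left has no subset of positive measure, and discarding a set of nonnegative measure
  cannot raise the value.\<close>

lemma negative_subset: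
  assumes \<mu>: "\<mu> \<in> signed_measures M" and D: "D \<in> sets M"
  obtains A where "negative_set M \<mu> A" "A \<subseteq> D" "\<mu> A \<le> \<mu> D"
proof -
  have Q: "{A \<in> sets M. A \<subseteq> D} \<subseteq> sets M" "{} \<in> {A \<in> sets M. A \<subseteq> D}"
    by auto
  obtain B :: "nat \<Rightarrow> 'a set" where
    B: "range B \<subseteq> {A \<in> sets M. A \<subseteq> D}" "disjoint_family B" "\<forall>i. 0 \<le> \<mu> (B i)"
      "\<forall>C\<in>{A \<in> sets M. A \<subseteq> D}. C \<inter> (\<Union>i. B i) = {} \<longrightarrow> \<mu> C \<le> 0"
    using greedy_exhaustion[OF \<mu> Q] .
  define U where "U = (\<Union>i. B i)"
  have U: "U \<in> sets M" "U \<subseteq> D"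
    using B(1) by (auto simp: U_def)
  have "(\<lambda>i. \<mu> (B i)) sums \<mu> U"
    unfolding U_def using B by (intro signed_measures_sums[OF \<mu>]) auto
  from sums_le[OF B(3)[rule_format] sums_zero this] have "0 \<le> \<mu> U" .
  moreover have "\<mu> D = \<mu> U + \<mu> (D - U)"
    using signed_measures_Int_Diff[OF \<mu> D U(1)] U(2) by (simp add: Int_absorb1)
  moreover have "\<mu> A \<le> 0" if "A \<in> sets M" "A \<subseteq> D - U" for A
  proof -
    have "A \<subseteq> D" "A \<inter> (\<Union>i. B i) = {}"
      using that(2) by (auto simp: U_def)
    then show ?thesis
      using B(4) that(1) by blast
  qed
  then have "negative_set M \<mu> (D - U)"
    using U D by (auto simp: negative_set_def)
  ultimately show ?thesis
    by (intro that[of "D - U"]) auto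
qed

lemma negative_set_UN:
  fixes B :: "nat \<Rightarrow> 'a set"
  assumes \<mu>: "\<mu> \<in> signed_measures M" and B: "\<And>i. negative_set M \<mu> (B i)" "disjoint_family B"
  shows "negative_set M \<mu> (\<Union>i. B i)"
proof -
  have "\<mu> A \<le> 0" if A: "A \<in> sets M" "A \<subseteq> (\<Union>i. B i)" for A
  proof -
    have "(\<lambda>i. \<mu> (A \<inter> B i)) sums \<mu> (\<Union>i. A \<inter> B i)"
    proof (rule signed_measures_sums[OF \<mu>])
      show "range (\<lambda>i. A \<inter> B i) \<subseteq> sets M"
        using B(1) A by (auto simp: negative_set_def)
      show "disjoint_family (\<lambda>i. A \<inter> B i)"
        using B(2) by (rule disjoint_family_on_bisimulation) auto
    qed
    moreover have "(\<Union>i. A \<inter> B i) = A"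
      using A by auto
    ultimately have sums: "(\<lambda>i. \<mu> (A \<inter> B i)) sums \<mu> A"
      by simp
    have "\<mu> (A \<inter> B i) \<le> 0" for i
      using B(1)[of i] A unfolding negative_set_def by blast
    from sums_le[OF this sums sums_zero] show ?thesis .
  qed
  then show ?thesis
    using B by (auto simp: negative_set_def)
qed

text \<open>Greedy exhaustion is applied to \<open>-\<mu>\<close> and the family of negative sets,
  and gives a negative set \<open>U\<close>. A set of negative measure outside \<open>U\<close>
  would contain, by \<open>negative_subset\<close>, a negative set of negative measure that the
  exhaustion rules out. So the complement of \<open>U\<close> is a Hahn set.\<close>

theorem hahn_set_exists:
  assumes \<mu>: "\<mu> \<in> signed_measures M"
  obtains X where "hahn_set M \<mu> X"
proof -
  have Q: "{A. negative_set M \<mu> A} \<subseteq> sets M" "{} \<in> {A. negative_set M \<mu> A}"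
    using \<mu> by (auto simp: negative_set_def)
  obtain B :: "nat \<Rightarrow> 'a set" where
    B: "range B \<subseteq> {A. negative_set M \<mu> A}" "disjoint_family B" "\<forall>i. 0 \<le> - \<mu> (B i)"
      "\<forall>C\<in>{A. negative_set M \<mu> A}. C \<inter> (\<Union>i. B i) = {} \<longrightarrow> - \<mu> C \<le> 0"
    using greedy_exhaustion[OF signed_measures_uminus[OF \<mu>] Q] .
  define U where "U = (\<Union>i. B i)"
  have U: "negative_set M \<mu> U"
    unfolding U_def using B by (intro negative_set_UN[OF \<mu>]) auto
  have pos: "0 \<le> \<mu> D" if D: "D \<in> sets M" "D \<inter> U = {}" for D
  proof -
    obtain A where A: "negative_set M \<mu> A" "A \<subseteq> D" "\<mu> A \<le> \<mu> D"
      using negative_subset[OF \<mu> D(1)] .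
    have "A \<inter> (\<Union>i. B i) = {}"
      using D(2) A(2) by (auto simp: U_def)
    with B(4)[rule_format, OF _ this] A(1) have "- \<mu> A \<le> 0"
      by simp
    then show ?thesis
      using A(3) by linarith
  qed
  have neg: "\<mu> A \<le> 0" if "A \<in> sets M" "A \<inter> (space M - U) = {}" for A
  proof -
    have "A \<subseteq> U"
      using that sets.sets_into_space[OF that(1)] by auto
    then show ?thesis
      using U that(1) by (simp add: negative_set_def)
  qed
  have "space M - U \<in> sets M"
    using U by (auto simp: negative_set_def)
  moreover have "0 \<le> \<mu> A" if "A \<in> sets M" "A \<subseteq> space M - U" for A
    using that by (intro pos) auto
  ultimately have "hahn_set M \<mu> (space M - U)"
    using neg by (simp add: hahn_set_def)
  then show ?thesis
    by (rule that)
qed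

section \<open>Jordan decomposition\<close>

lemma nonneg_signed_measure_is_measure:
  assumes \<mu>: "\<mu> \<in> signed_measures M" and nonneg: "\<And>A. A \<in> sets M \<Longrightarrow> 0 \<le> \<mu> A"
  obtains P where "sets P = sets M" "finite_measure P" "\<forall>A\<in>sets M. measure P A = \<mu> A"
proof -
  define P where "P = measure_of (space M) (sets M) (\<lambda>A. ennreal (\<mu> A))"
  have sets: "sets P = sets M"
    by (simp add: P_def)
  have "countably_additive (sets M) (\<lambda>A. ennreal (\<mu> A))"
  proof (rule countably_additiveI)
    fix A :: "nat \<Rightarrow> 'a set"
    assume A: "range A \<subseteq> sets M" "disjoint_family A" "\<Union> (range A) \<in> sets M"
    have "(\<lambda>i. \<mu> (A i)) sums \<mu> (\<Union>i. A i)"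
      using A by (intro signed_measures_sums[OF \<mu>])
    then show "(\<Sum>i. ennreal (\<mu> (A i))) = ennreal (\<mu> (\<Union> (range A)))"
      using nonneg A(1) by (simp add: suminf_ennreal2 sums_iff image_subset_iff)
  qed
  then have em: "emeasure P A = ennreal (\<mu> A)" if "A \<in> sets M" for A
    using that \<mu> by (intro emeasure_measure_of[OF P_def])
      (auto simp: sets positive_def sets.space_closed)
  have "emeasure P (space P) \<noteq> \<infinity>"
    using em[OF sets.top] sets_eq_imp_space_eq[OF sets] by simp
  then have "finite_measure P"
    by (rule finite_measureI)
  moreover have "\<forall>A\<in>sets M. measure P A = \<mu> A"
    using em nonneg by (simp add: measure_def)
  ultimately show ?thesis
    by (rule that[OF sets])
qed

text \<open>The parts are the restriction of \<open>\<mu>\<close> to a Hahn set and that of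
  \<open>-\<mu>\<close> to its complement. The Hahn set itself witnesses mutual singularity.\<close>

lemma jordan_decomposition_exists:
  assumes \<mu>: "\<mu> \<in> signed_measures M"
  obtains P N where "is_jordan_decomposition M \<mu> P N"
proof -
  obtain X where X: "hahn_set M \<mu> X"
    using hahn_set_exists[OF \<mu>] .
  then have XM: "X \<in> sets M"
    by (simp add: hahn_set_def)
  have Diff: "A \<inter> (space M - X) = A - X" if "A \<in> sets M" for A
    using sets.sets_into_space[OF that] by auto
  obtain P where P: "sets P = sets M" "finite_measure P"
    "\<forall>A\<in>sets M. measure P A = signed_restrict M \<mu> X A"
  proof (rule nonneg_signed_measure_is_measure[OF signed_restrict_signed_measures[OF \<mu> XM]])
    show "0 \<le> signed_restrict M \<mu> X A" if "A \<in> sets M" for A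
      using hahn_set_Int_nonneg[OF X that] by (simp add: signed_restrict_def)
  qed
  have neg_restrict: "(\<lambda>A. - signed_restrict M \<mu> (space M - X) A) \<in> signed_measures M"
    using XM \<mu> by (intro signed_measures_uminus signed_restrict_signed_measures) auto
  obtain N where N: "sets N = sets M" "finite_measure N"
    "\<forall>A\<in>sets M. measure N A = - signed_restrict M \<mu> (space M - X) A"
  proof (rule nonneg_signed_measure_is_measure[OF neg_restrict])
    show "0 \<le> - signed_restrict M \<mu> (space M - X) A" if "A \<in> sets M" for A
      using hahn_set_Diff_nonpos[OF X that] by (simp add: signed_restrict_def Diff[OF that])
  qed
  have "mutually_singular M P N"
    unfolding mutually_singular_def
  proof (intro bexI[OF _ XM] conjI)
    have "(space M - X) \<inter> X = {}" "X \<inter> (space M - X) = {}"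
      by auto
    then have "measure P (space M - X) = 0" "measure N X = 0"
      using XM P(3) N(3) \<mu> by (simp_all add: signed_restrict_def)
    then show "emeasure P (space M - X) = 0" "emeasure N X = 0"
      using P(2) N(2) by (simp_all add: finite_measure.emeasure_eq_measure)
  qed
  moreover have "\<mu> A = measure P A - measure N A" if "A \<in> sets M" for A
    using signed_measures_Int_Diff[OF \<mu> that XM] P(3) N(3) that
    by (simp add: signed_restrict_def Diff)
  ultimately have "is_jordan_decomposition M \<mu> P N"
    using P N by (simp add: is_jordan_decomposition_def)
  then show ?thesis
    by (rule that)
qed

text \<open>Inside the set that witnesses singularity \<open>N\<close> vanishes and
  \<open>\<mu>\<close> is \<open>P\<close>; outside it \<open>P\<close> vanishes and
  \<open>\<mu>\<close> is \<open>-N\<close>. Both parts are thus determined by \<open>\<mu>\<close>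
  and a Hahn set, which reduces their uniqueness to that of Hahn sets up to null sets.\<close>

lemma jordan_decomposition_hahn_set:
  assumes "is_jordan_decomposition M \<mu> P N"
  obtains X where "hahn_set M \<mu> X"
    "\<forall>A\<in>sets M. emeasure P A = ennreal (\<mu> (A \<inter> X))"
    "\<forall>A\<in>sets M. emeasure N A = ennreal (- \<mu> (A - X))"
proof -
  interpret P: finite_measure P
    using assms by (simp add: is_jordan_decomposition_def)
  interpret N: finite_measure N
    using assms by (simp add: is_jordan_decomposition_def)
  have sets: "sets P = sets M" "sets N = sets M"
    and eq: "\<And>A. A \<in> sets M \<Longrightarrow> \<mu> A = measure P A - measure N A"
    using assms by (auto simp: is_jordan_decomposition_def)
  obtain X where X: "X \<in> sets M" "emeasure P (space M - X) = 0" "emeasure N X = 0"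
    using assms by (auto simp: is_jordan_decomposition_def mutually_singular_def)
  have P0: "measure P A = 0" if "A \<in> sets M" "A \<inter> X = {}" for A
  proof -
    have "emeasure P A \<le> emeasure P (space M - X)"
      using that X sets sets.sets_into_space[OF that(1)] by (intro emeasure_mono) auto
    then show ?thesis
      using X by (simp add: measure_def)
  qed
  have N0: "measure N A = 0" if "A \<in> sets M" "A \<subseteq> X" for A
  proof -
    have "emeasure N A \<le> emeasure N X"
      using that X sets by (intro emeasure_mono) auto
    then show ?thesis
      using X by (simp add: measure_def)
  qed
  have "hahn_set M \<mu> X"
    using X(1) by (auto simp: hahn_set_def eq P0 N0)
  moreover have "measure P A = \<mu> (A \<inter> X)" if A: "A \<in> sets M" for A
  proof -
    have "measure P A = measure P (A \<inter> X) + measure P (A - X)"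
      using A X sets P.finite_measure_Union[of "A \<inter> X" "A - X"]
      by (auto simp: Int_Diff_Un)
    also have "\<dots> = \<mu> (A \<inter> X)"
      using A X(1) by (simp add: eq N0 P0 Diff_Int_distrib2)
    finally show ?thesis .
  qed
  moreover have "measure N A = - \<mu> (A - X)" if A: "A \<in> sets M" for A
  proof -
    have "measure N A = measure N (A \<inter> X) + measure N (A - X)"
      using A X sets N.finite_measure_Union[of "A \<inter> X" "A - X"]
      by (auto simp: Int_Diff_Un)
    also have "\<dots> = - \<mu> (A - X)"
      using A X(1) by (simp add: eq N0 P0 Diff_Int_distrib2)
    finally show ?thesis .
  qed
  ultimately show ?thesis
    using that[of X] by (simp add: P.emeasure_eq_measure N.emeasure_eq_measure)
qed

text \<open>The piece of \<open>A\<close> in \<open>X\<close> but not in \<open>Y\<close> has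
  nonnegative measure by the first Hahn set and nonpositive measure by the second, hence measure 0.
  By symmetry both sides equal \<open>\<mu> (A \<inter> X \<inter> Y)\<close>.\<close>

lemma hahn_set_unique:
  assumes \<mu>: "\<mu> \<in> signed_measures M" and X: "hahn_set M \<mu> X" and Y: "hahn_set M \<mu> Y"
    and A: "A \<in> sets M"
  shows "\<mu> (A \<inter> X) = \<mu> (A \<inter> Y)"
proof -
  have *: "\<mu> (A \<inter> X) = \<mu> (A \<inter> X \<inter> Y)" if X: "hahn_set M \<mu> X" and Y: "hahn_set M \<mu> Y" for X Y
  proof -
    have XY: "X \<in> sets M" "Y \<in> sets M"
      using X Y by (auto simp: hahn_set_def)
    have "A \<inter> X - Y = (A - Y) \<inter> X"
      by auto
    then have "0 \<le> \<mu> (A \<inter> X - Y)"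
      using hahn_set_Int_nonneg[OF X, of "A - Y"] XY A by simp
    moreover have "\<mu> (A \<inter> X - Y) \<le> 0"
      using hahn_set_Diff_nonpos[OF Y, of "A \<inter> X"] XY A by simp
    ultimately show ?thesis
      using signed_measures_Int_Diff[OF \<mu>, of "A \<inter> X" Y] A XY by auto
  qed
  have "A \<inter> X \<inter> Y = A \<inter> Y \<inter> X"
    by auto
  then show ?thesis
    using *[OF X Y] *[OF Y X] by simp
qed

lemma jordan_decomposition_unique:
  assumes \<mu>: "\<mu> \<in> signed_measures M"
    and J: "is_jordan_decomposition M \<mu> P N" and J': "is_jordan_decomposition M \<mu> P' N'"
  shows "P = P'" "N = N'"
proof -
  obtain X where X: "hahn_set M \<mu> X"
    "\<forall>A\<in>sets M. emeasure P A = ennreal (\<mu> (A \<inter> X))"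
    "\<forall>A\<in>sets M. emeasure N A = ennreal (- \<mu> (A - X))"
    using jordan_decomposition_hahn_set[OF J] .
  obtain Y where Y: "hahn_set M \<mu> Y"
    "\<forall>A\<in>sets M. emeasure P' A = ennreal (\<mu> (A \<inter> Y))"
    "\<forall>A\<in>sets M. emeasure N' A = ennreal (- \<mu> (A - Y))"
    using jordan_decomposition_hahn_set[OF J'] .
  have sets: "sets P = sets M" "sets N = sets M" "sets P' = sets M" "sets N' = sets M"
    using J J' by (auto simp: is_jordan_decomposition_def)
  have Int: "\<mu> (A \<inter> X) = \<mu> (A \<inter> Y)" if "A \<in> sets M" for A
    using hahn_set_unique[OF \<mu> X(1) Y(1) that] .
  have Diff: "\<mu> (A - X) = \<mu> (A - Y)" if "A \<in> sets M" for A
    using Int[OF that] signed_measures_Int_Diff[OF \<mu> that, of X]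
      signed_measures_Int_Diff[OF \<mu> that, of Y] X(1) Y(1) by (auto simp: hahn_set_def)
  show "P = P'"
    by (rule measure_eqI) (auto simp: sets X Y Int)
  show "N = N'"
    by (rule measure_eqI) (auto simp: sets X Y Diff)
qed

text \<open>Existence and uniqueness justify the definite description behind
  \<open>jordan_pos\<close> and \<open>jordan_neg\<close>. Everything below uses them only through
  this property.\<close>

lemma jordan_pos_neg:
  assumes \<mu>: "\<mu> \<in> signed_measures M"
  shows "is_jordan_decomposition M \<mu> (jordan_pos M \<mu>) (jordan_neg M \<mu>)"
proof -
  obtain P N where J: "is_jordan_decomposition M \<mu> P N"
    using jordan_decomposition_exists[OF \<mu>] .
  have "jordan_decomposition M \<mu> = (P, N)"
    unfolding jordan_decomposition_def
  proof (rule the_equality)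
    show "case (P, N) of (P, N) \<Rightarrow> is_jordan_decomposition M \<mu> P N"
      using J by simp
    show "D = (P, N)" if "case D of (P, N) \<Rightarrow> is_jordan_decomposition M \<mu> P N" for D
    proof (cases D)
      case (Pair P' N')
      with that have "is_jordan_decomposition M \<mu> P' N'"
        by simp
      from jordan_decomposition_unique[OF \<mu> J this] show ?thesis
        by (simp add: Pair)
    qed
  qed
  then show ?thesis
    using J by (simp add: jordan_pos_def jordan_neg_def)
qed

lemma
  assumes "\<mu> \<in> signed_measures M"
  shows sets_jordan_pos: "sets (jordan_pos M \<mu>) = sets M"
    and sets_jordan_neg: "sets (jordan_neg M \<mu>) = sets M"
    and finite_measure_jordan_pos: "finite_measure (jordan_pos M \<mu>)"
    and finite_measure_jordan_neg: "finite_measure (jordan_neg M \<mu>)"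
    and signed_measure_eq_diff:
      "A \<in> sets M \<Longrightarrow> \<mu> A = measure (jordan_pos M \<mu>) A - measure (jordan_neg M \<mu>) A"
  using jordan_pos_neg[OF assms] unfolding is_jordan_decomposition_def by blast+

section \<open>Linearity of the integral\<close>

text \<open>Additivity of the integral in the measure, phrased with finite families so that no sum
  of measures has to be constructed. The identity passes from indicators to all nonnegative
  measurable functions by the usual induction.\<close>

lemma sum_nn_integral_eq:
  fixes P :: "'i \<Rightarrow> 'a measure" and Q :: "'j \<Rightarrow> 'a measure"
  assumes sets: "\<And>i. i \<in> I \<Longrightarrow> sets (P i) = sets M" "\<And>j. j \<in> J \<Longrightarrow> sets (Q j) = sets M"
    and eq: "\<And>E. E \<in> sets M \<Longrightarrow> (\<Sum>i\<in>I. emeasure (P i) E) = (\<Sum>j\<in>J. emeasure (Q j) E)"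
    and f: "f \<in> borel_measurable M"
  shows "(\<Sum>i\<in>I. nn_integral (P i) f) = (\<Sum>j\<in>J. nn_integral (Q j) f)"
  using f
proof (induction rule: borel_measurable_induct)
  case (cong f g)
  then have "nn_integral K f = nn_integral K g" if "sets K = sets M" for K
    using sets_eq_imp_space_eq[OF that] by (intro nn_integral_cong) auto
  then show ?case
    using cong sets by simp
next
  case (set E)
  then show ?case
    using sets eq by simp
next
  case (mult f c)
  have "f \<in> borel_measurable K" if "sets K = sets M" for K
    using mult(2) by (simp add: measurable_cong_sets[OF that refl])
  then show ?case
    using mult.IH sets by (simp add: nn_integral_cmult sum_distrib_left[symmetric])
next
  case (add f g)
  have "f \<in> borel_measurable K" "g \<in> borel_measurable K" if "sets K = sets M" for K
    using add by (simp_all add: measurable_cong_sets[OF that refl])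
  then show ?case
    using add.IH sets by (simp add: nn_integral_add sum.distrib)
next
  case (seq F)
  have sup: "nn_integral K (Sup (range F)) = (SUP i. nn_integral K (F i))" if "sets K = sets M" for K
  proof -
    have "F i \<in> borel_measurable K" for i
      using seq(1) by (simp add: measurable_cong_sets[OF that refl])
    moreover have "Sup (range F) = (\<lambda>x. SUP i. F i x)"
      by (simp add: fun_eq_iff image_image)
    ultimately show ?thesis
      using nn_integral_monotone_convergence_SUP[OF seq(3), of K] by simp
  qed
  have inc: "incseq (\<lambda>i. nn_integral K (F i))" for K
    using seq(3) by (auto simp: incseq_def le_fun_def intro!: nn_integral_mono)
  \<comment> \<open>Finite sums commute with these suprema because the integrals increase with the
    index of \<open>F\<close>.\<close>
  have "(\<Sum>i\<in>I. nn_integral (P i) (Sup (range F))) = (SUP n. \<Sum>i\<in>I. nn_integral (P i) (F n))"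
    using sets(1) by (simp only: sup ennreal_SUP_sum[OF inc] cong: sum.cong)
  moreover have "(\<Sum>j\<in>J. nn_integral (Q j) (Sup (range F))) = (SUP n. \<Sum>j\<in>J. nn_integral (Q j) (F n))"
    using sets(2) by (simp only: sup ennreal_SUP_sum[OF inc] cong: sum.cong)
  ultimately show ?case
    using seq.IH by (simp only: seq.hyps)
qed

lemma sum_integral_eq:
  fixes f :: "'a \<Rightarrow> real" and P :: "'i \<Rightarrow> 'a measure" and Q :: "'j \<Rightarrow> 'a measure"
  assumes P: "\<And>i. i \<in> I \<Longrightarrow> sets (P i) = sets M" "\<And>i. i \<in> I \<Longrightarrow> finite_measure (P i)"
    and Q: "\<And>j. j \<in> J \<Longrightarrow> sets (Q j) = sets M" "\<And>j. j \<in> J \<Longrightarrow> finite_measure (Q j)"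
    and eq: "\<And>E. E \<in> sets M \<Longrightarrow> (\<Sum>i\<in>I. measure (P i) E) = (\<Sum>j\<in>J. measure (Q j) E)"
    and f: "f \<in> borel_measurable M" "\<And>x. x \<in> space M \<Longrightarrow> \<bar>f x\<bar> \<le> c"
  shows "(\<Sum>i\<in>I. integral\<^sup>L (P i) f) = (\<Sum>j\<in>J. integral\<^sup>L (Q j) f)"
proof -
  have int: "integrable K f" if "sets K = sets M" "finite_measure K" for K
  proof (rule finite_measure.integrable_const_bound[OF that(2), of _ c])
    show "f \<in> borel_measurable K"
      using f(1) by (simp add: measurable_cong_sets[OF that(1) refl])
    show "AE x in K. norm (f x) \<le> c"
      using f(2) sets_eq_imp_space_eq[OF that(1)] by (intro AE_I2) auto
  qed
  have em: "(\<Sum>i\<in>I. emeasure (P i) E) = (\<Sum>j\<in>J. emeasure (Q j) E)" if "E \<in> sets M" for E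
    using eq[OF that] P(2) Q(2)
    by (simp add: finite_measure.emeasure_eq_measure sum_ennreal)
  \<comment> \<open>As \<open>ennreal\<close> sends negative reals to 0, the two choices of
    \<open>g\<close> yield the positive and the negative part of \<open>f\<close>. Their integrals
    are finite, so \<open>enn2real\<close> commutes with the sums.\<close>
  have *: "(\<Sum>i\<in>I. enn2real (nn_integral (P i) (\<lambda>x. ennreal (g x))))
      = (\<Sum>j\<in>J. enn2real (nn_integral (Q j) (\<lambda>x. ennreal (g x))))"
    if g: "g = f \<or> g = (\<lambda>x. - f x)" for g
  proof -
    have fin: "nn_integral K (\<lambda>x. ennreal (g x)) < top" if "sets K = sets M" "finite_measure K" for K
      using int[OF that] g by (auto simp: real_integrable_def top.not_eq_extremum)
    have "(\<lambda>x. ennreal (g x)) \<in> borel_measurable M"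
      using g f(1) by auto
    note sum_nn_integral_eq[OF P(1) Q(1) em this]
    moreover have "enn2real (\<Sum>i\<in>I. nn_integral (P i) (\<lambda>x. ennreal (g x)))
        = (\<Sum>i\<in>I. enn2real (nn_integral (P i) (\<lambda>x. ennreal (g x))))"
      using fin P by (subst enn2real_sum) (simp_all add: comp_def)
    moreover have "enn2real (\<Sum>j\<in>J. nn_integral (Q j) (\<lambda>x. ennreal (g x)))
        = (\<Sum>j\<in>J. enn2real (nn_integral (Q j) (\<lambda>x. ennreal (g x))))"
      using fin Q by (subst enn2real_sum) (simp_all add: comp_def)
    ultimately show ?thesis
      by simp
  qed
  show ?thesis
    using *[of f] *[of "\<lambda>x. - f x"] int P Q
    by (simp add: real_lebesgue_integral_def sum_subtractf)
qed

text \<open>The Jordan parts of a difference are in general not the differences of the Jordan parts,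
  so linearity is not immediate from the definition. The bound on \<open>f\<close> makes all the
  integrals finite.\<close>

lemma signed_integral_diff:
  assumes \<mu>: "\<mu> \<in> signed_measures M" and \<nu>: "\<nu> \<in> signed_measures M"
    and f: "f \<in> borel_measurable M" "\<And>x. x \<in> space M \<Longrightarrow> \<bar>f x\<bar> \<le> c"
  shows "signed_integral M (\<lambda>A. \<mu> A - \<nu> A) f = signed_integral M \<mu> f - signed_integral M \<nu> f"
proof -
  define \<rho> where "\<rho> = (\<lambda>A. \<mu> A - \<nu> A)"
  have \<rho>: "\<rho> \<in> signed_measures M"
    unfolding \<rho>_def using \<mu> \<nu> by (rule signed_measures_diff)
  \<comment> \<open>Moving the negative terms across, the defining relation of \<open>\<rho>\<close> becomes an identity between
    sums of three positive measures.\<close>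
  define P where "P = (!) [jordan_pos M \<rho>, jordan_neg M \<mu>, jordan_pos M \<nu>]"
  define N where "N = (!) [jordan_neg M \<rho>, jordan_pos M \<mu>, jordan_neg M \<nu>]"
  have P: "P 0 = jordan_pos M \<rho>" "P 1 = jordan_neg M \<mu>" "P 2 = jordan_pos M \<nu>"
    and N: "N 0 = jordan_neg M \<rho>" "N 1 = jordan_pos M \<mu>" "N 2 = jordan_neg M \<nu>"
    by (simp_all add: P_def N_def)
  have sets: "sets (P i) = sets M" "sets (N i) = sets M" if "i \<in> {0, 1, 2}" for i
    using that \<mu> \<nu> \<rho>
    by (elim insertE; simp add: P[simplified] N[simplified] sets_jordan_pos sets_jordan_neg)+
  have finite: "finite_measure (P i)" "finite_measure (N i)" if "i \<in> {0, 1, 2}" for i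
    using that \<mu> \<nu> \<rho>
    by (elim insertE; simp add: P[simplified] N[simplified] finite_measure_jordan_pos finite_measure_jordan_neg)+
  have "(\<Sum>i\<in>{0, 1, 2}. measure (P i) E) = (\<Sum>i\<in>{0, 1, 2}. measure (N i) E)" if "E \<in> sets M" for E
  proof -
    have "\<rho> E = \<mu> E - \<nu> E"
      by (simp add: \<rho>_def)
    then show ?thesis
      using signed_measure_eq_diff[OF \<mu> that] signed_measure_eq_diff[OF \<nu> that]
        signed_measure_eq_diff[OF \<rho> that] by (simp add: P[simplified] N[simplified])
  qed
  then have "(\<Sum>i\<in>{0, 1, 2}. integral\<^sup>L (P i) f) = (\<Sum>i\<in>{0, 1, 2}. integral\<^sup>L (N i) f)"
    by (intro sum_integral_eq[OF sets(1) finite(1) sets(2) finite(2) _ f])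
  then show ?thesis
    unfolding \<rho>_def[symmetric] by (simp add: P[simplified] N[simplified] signed_integral_def)
qed

section \<open>Total variation\<close>

lemma tv_norm_hahn:
  assumes \<mu>: "\<mu> \<in> signed_measures M" and X: "hahn_set M \<mu> X" and ne: "space M \<noteq> {}"
  shows "tv_norm M \<mu> = \<mu> X - \<mu> (space M - X)"
proof -
  have XM: "X \<in> sets M"
    using X by (simp add: hahn_set_def)
  have Xsp: "X \<subseteq> space M"
    using XM sets.sets_into_space by auto
  have pos: "0 \<le> \<mu> X" and neg: "\<mu> (space M - X) \<le> 0"
    using hahn_set_Int_nonneg[OF X XM] hahn_set_Diff_nonpos[OF X sets.top] by simp_all
  have upper: "(\<Sum>E\<in>\<E>. \<bar>\<mu> E\<bar>) \<le> \<mu> X - \<mu> (space M - X)"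
    if \<E>: "finite \<E>" "\<E> \<subseteq> sets M" "partition_on (space M) \<E>" for \<E>
  proof -
    \<comment> \<open>The restriction to \<open>Y\<close> is again a signed measure, so additivity
      over the cells applies to it. It is used for \<open>X\<close> and for its complement.\<close>
    have sum: "(\<Sum>E\<in>\<E>. \<mu> (E \<inter> Y)) = \<mu> Y" if Y: "Y \<in> sets M" for Y
    proof -
      define \<nu> where "\<nu> = signed_restrict M \<mu> Y"
      have "\<nu> (\<Union>\<E>) = (\<Sum>E\<in>\<E>. \<nu> E)"
        unfolding \<nu>_def using \<E>
        by (intro signed_measures_Union[OF signed_restrict_signed_measures[OF \<mu> Y]])
          (auto simp: partition_on_def)
      moreover have "\<nu> (\<Union>\<E>) = \<mu> Y"
        using \<E>(3) Y sets.sets_into_space[OF Y]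
        by (auto simp: \<nu>_def signed_restrict_def partition_on_def Int_absorb1)
      moreover have "(\<Sum>E\<in>\<E>. \<nu> E) = (\<Sum>E\<in>\<E>. \<mu> (E \<inter> Y))"
        using \<E>(2) by (intro sum.cong) (auto simp: \<nu>_def signed_restrict_def)
      ultimately show ?thesis
        by simp
    qed
    have "\<bar>\<mu> E\<bar> \<le> \<mu> (E \<inter> X) - \<mu> (E \<inter> (space M - X))" if "E \<in> \<E>" for E
    proof -
      have E: "E \<in> sets M"
        using that \<E> by auto
      have "E \<inter> (space M - X) = E - X"
        using sets.sets_into_space[OF E] by auto
      then show ?thesis
        using signed_measures_Int_Diff[OF \<mu> E XM] hahn_set_Int_nonneg[OF X E]
          hahn_set_Diff_nonpos[OF X E] by simp
    qed
    then have "(\<Sum>E\<in>\<E>. \<bar>\<mu> E\<bar>) \<le> (\<Sum>E\<in>\<E>. \<mu> (E \<inter> X) - \<mu> (E \<inter> (space M - X)))"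
      by (rule sum_mono)
    also have "\<dots> = \<mu> X - \<mu> (space M - X)"
      using sum XM by (simp add: sum_subtractf)
    finally show ?thesis .
  qed
  \<comment> \<open>A partition has no empty cell, so the empty set is removed in case
    \<open>X\<close> or its complement is empty. This changes no sum, as \<open>\<mu> {}\<close> is
    0.\<close>
  define \<E> where "\<E> = {X, space M - X} - {{}}"
  have \<E>: "finite \<E>" "\<E> \<subseteq> sets M" "partition_on (space M) \<E>"
    using XM Xsp by (auto simp: \<E>_def partition_on_def disjoint_def)
  have "(\<Sum>E\<in>\<E>. \<bar>\<mu> E\<bar>) = (\<Sum>E\<in>{X, space M - X}. \<bar>\<mu> E\<bar>)"
    unfolding \<E>_def using \<mu> by (intro sum.mono_neutral_left) auto
  also have "\<dots> = \<mu> X - \<mu> (space M - X)"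
  proof -
    \<comment> \<open>Otherwise the two-element set would collapse and the sum would have a single
      term. A set equals its complement only in an empty space.\<close>
    have "X \<noteq> space M - X"
      using Xsp ne by auto
    then show ?thesis
      using pos neg by simp
  qed
  finally have attained: "(\<Sum>E\<in>\<E>. \<bar>\<mu> E\<bar>) = \<mu> X - \<mu> (space M - X)" .
  show ?thesis
    unfolding tv_norm_def
  proof (rule antisym)
    show "(SUP \<E>\<in>{\<E>. finite \<E> \<and> \<E> \<subseteq> sets M \<and> partition_on (space M) \<E>}. \<Sum>E\<in>\<E>. \<bar>\<mu> E\<bar>)
        \<le> \<mu> X - \<mu> (space M - X)"
      using \<E> upper by (intro cSUP_least) auto
    show "\<mu> X - \<mu> (space M - X)
        \<le> (SUP \<E>\<in>{\<E>. finite \<E> \<and> \<E> \<subseteq> sets M \<and> partition_on (space M) \<E>}. \<Sum>E\<in>\<E>. \<bar>\<mu> E\<bar>)"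
      unfolding attained[symmetric] using \<E> upper attained
      by (intro cSUP_upper) (auto intro!: bdd_aboveI2)
  qed
qed

text \<open>Passing from \<open>A\<close> to a Hahn set \<open>X\<close> drops \<open>A - X\<close>,
  of nonpositive measure, and gains \<open>X - A\<close>, of nonnegative measure. So the left side
  is largest at \<open>X\<close>, where it is the norm.\<close>

lemma diff_le_tv_norm:
  assumes \<mu>: "\<mu> \<in> signed_measures M" and ne: "space M \<noteq> {}" and A: "A \<in> sets M"
  shows "\<mu> A - \<mu> (space M - A) \<le> tv_norm M \<mu>"
proof -
  obtain X where X: "hahn_set M \<mu> X"
    using hahn_set_exists[OF \<mu>] .
  then have XM: "X \<in> sets M"
    by (simp add: hahn_set_def)
  have "(space M - A) \<inter> X = X - A"
    using sets.sets_into_space[OF XM] by auto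
  then have "\<mu> (A - X) \<le> 0" "0 \<le> \<mu> (X - A)"
    using hahn_set_Diff_nonpos[OF X A] hahn_set_Int_nonneg[OF X, of "space M - A"] A by simp_all
  moreover have "\<mu> A = \<mu> (A \<inter> X) + \<mu> (A - X)"
    using signed_measures_Int_Diff[OF \<mu> A XM] .
  moreover have "\<mu> X = \<mu> (A \<inter> X) + \<mu> (X - A)"
    using signed_measures_Int_Diff[OF \<mu> XM A] by (simp add: Int_commute)
  moreover have "\<mu> (space M) = \<mu> A + \<mu> (space M - A)" "\<mu> (space M) = \<mu> X + \<mu> (space M - X)"
    using signed_measures_Int_Diff[OF \<mu> sets.top A] signed_measures_Int_Diff[OF \<mu> sets.top XM]
      sets.sets_into_space[OF A] sets.sets_into_space[OF XM] by (simp_all add: Int_absorb1)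
  ultimately show ?thesis
    using tv_norm_hahn[OF \<mu> X ne] by linarith
qed

text \<open>At a Hahn set \<open>X\<close> of the difference its norm splits into one term for each
  measure. The first is bounded by testing \<open>\<mu>\<close> on \<open>X\<close>, the second by
  testing \<open>\<nu>\<close> on the complement, which absorbs the minus sign.\<close>

lemma tv_norm_diff_le:
  assumes \<mu>: "\<mu> \<in> signed_measures M" and \<nu>: "\<nu> \<in> signed_measures M" and ne: "space M \<noteq> {}"
  shows "tv_norm M (\<lambda>A. \<mu> A - \<nu> A) \<le> tv_norm M \<mu> + tv_norm M \<nu>"
proof -
  have \<rho>: "(\<lambda>A. \<mu> A - \<nu> A) \<in> signed_measures M"
    using \<mu> \<nu> by (rule signed_measures_diff)
  obtain X where X: "hahn_set M (\<lambda>A. \<mu> A - \<nu> A) X"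
    using hahn_set_exists[OF \<rho>] .
  then have XM: "X \<in> sets M"
    by (simp add: hahn_set_def)
  have "space M - (space M - X) = X"
    using sets.sets_into_space[OF XM] by auto
  then show ?thesis
    using tv_norm_hahn[OF \<rho> X ne] diff_le_tv_norm[OF \<mu> ne XM]
      diff_le_tv_norm[OF \<nu> ne, of "space M - X"] XM by simp
qed

lemma tv_norm_restrict_add:
  assumes \<mu>: "\<mu> \<in> signed_measures M" and ne: "space M \<noteq> {}" and S: "S \<in> sets M"
  shows "tv_norm M \<mu> =
    tv_norm M (signed_restrict M \<mu> S) + tv_norm M (signed_restrict M \<mu> (space M - S))"
proof -
  obtain X where X: "hahn_set M \<mu> X"
    using hahn_set_exists[OF \<mu>] .
  then have XM: "X \<in> sets M"
    by (simp add: hahn_set_def)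
  have tv: "tv_norm M (signed_restrict M \<mu> T) = \<mu> (X \<inter> T) - \<mu> ((space M - X) \<inter> T)"
    if T: "T \<in> sets M" for T
  proof -
    have "hahn_set M (signed_restrict M \<mu> T) X"
      unfolding hahn_set_def
    proof (intro conjI ballI impI XM)
      fix A assume A: "A \<in> sets M"
      show "0 \<le> signed_restrict M \<mu> T A" if "A \<subseteq> X"
        using hahn_set_Int_nonneg[OF X, of "A \<inter> T"] that A T
        by (simp add: signed_restrict_def Int_absorb2 le_infI1)
      show "signed_restrict M \<mu> T A \<le> 0" if "A \<inter> X = {}"
      proof -
        have "A \<inter> T - X = A \<inter> T"
          using that by auto
        then show ?thesis
          using hahn_set_Diff_nonpos[OF X, of "A \<inter> T"] A T by (simp add: signed_restrict_def)
      qed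
    qed
    from tv_norm_hahn[OF signed_restrict_signed_measures[OF \<mu> T] this ne] show ?thesis
      using XM by (simp add: signed_restrict_def)
  qed
  have Diff: "X \<inter> (space M - S) = X - S" "(space M - X) \<inter> (space M - S) = (space M - X) - S"
    using sets.sets_into_space[OF XM] by auto
  show ?thesis
    using tv[OF S] tv[of "space M - S"] S XM tv_norm_hahn[OF \<mu> X ne]
      signed_measures_Int_Diff[OF \<mu> XM S] signed_measures_Int_Diff[OF \<mu> _ S, of "space M - X"]
    by (simp add: Diff)
qed

section \<open>Support\<close>

text \<open>Each point of \<open>A\<close> has an open neighbourhood whose trace on \<open>T\<close>
  is null. By the Lindelof property countably many such neighbourhoods cover
  \<open>A\<close>.\<close>

lemma emeasure_disjoint_support:
  fixes P :: "'a::second_countable_topology measure"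
  assumes sets: "sets P = sets (restrict_space borel T)"
    and A: "A \<in> sets P" "A \<inter> measure_support P = {}"
  shows "emeasure P A = 0"
proof -
  have space: "space P = T"
    using sets_eq_imp_space_eq[OF sets] by (simp add: space_restrict_space)
  define \<U> where "\<U> = {U. open U \<and> emeasure P (U \<inter> T) = 0}"
  obtain \<V> where \<V>: "\<V> \<subseteq> \<U>" "countable \<V>" "\<Union>\<V> = \<Union>\<U>"
    using Lindelof[of \<U>] by (auto simp: \<U>_def)
  have null: "(\<Union>U\<in>\<V>. U \<inter> T) \<in> null_sets P"
  proof (rule null_sets_UN'[OF \<V>(2)])
    fix U assume "U \<in> \<V>"
    then have "open U" "emeasure P (U \<inter> T) = 0"
      using \<V> by (auto simp: \<U>_def)
    moreover from this(1) have "U \<inter> T \<in> sets P"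
      unfolding sets sets_restrict_space by (intro image_eqI[of _ _ U]) auto
    ultimately show "U \<inter> T \<in> null_sets P"
      by (intro null_setsI)
  qed
  have "A \<subseteq> (\<Union>U\<in>\<V>. U \<inter> T)"
  proof
    fix x assume x: "x \<in> A"
    then have "x \<in> T"
      using sets.sets_into_space[OF A(1)] space by auto
    moreover from this obtain U where "U \<in> \<U>" "x \<in> U"
      using x A(2) by (auto simp: measure_support_def space \<U>_def zero_less_iff_neq_zero)
    ultimately show "x \<in> (\<Union>U\<in>\<V>. U \<inter> T)"
      using \<V>(3) by blast
  qed
  from null_sets_subset[OF null A(1) this] show ?thesis
    by (rule null_setsD1)
qed

lemma signed_measure_disjoint_jordan_support:
  fixes \<mu> :: "'a::second_countable_topology set \<Rightarrow> real"
  assumes \<mu>: "\<mu> \<in> signed_measures (restrict_space borel T)"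
    and supp: "jordan_support (restrict_space borel T) \<mu> = (Sp, Sn)"
    and A: "A \<in> sets (restrict_space borel T)" "A \<inter> (Sp \<union> Sn) = {}"
  shows "\<mu> A = 0"
proof -
  let ?M = "restrict_space borel T"
  note sets = sets_jordan_pos[OF \<mu>] sets_jordan_neg[OF \<mu>]
  have "A \<inter> measure_support (jordan_pos ?M \<mu>) = {}" "A \<inter> measure_support (jordan_neg ?M \<mu>) = {}"
    using supp A(2) by (auto simp: jordan_support_def)
  then have "emeasure (jordan_pos ?M \<mu>) A = 0" "emeasure (jordan_neg ?M \<mu>) A = 0"
    using A(1) by (simp_all add: emeasure_disjoint_support[OF sets(1)]
        emeasure_disjoint_support[OF sets(2)] sets)
  then show ?thesis
    by (simp add: signed_measure_eq_diff[OF \<mu> A(1)] measure_def)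
qed

section \<open>Minimal extrapolation\<close>

text \<open>Continuity on the compact interval supplies both the measurability and the bound that
  \<open>signed_integral_diff\<close> asks for.\<close>

lemma moment_map_diff:
  assumes u: "\<And>k. k \<le> n \<Longrightarrow> continuous_on {-1..1} (u k)"
    and "\<mu> \<in> signed_measures I_borel" "\<nu> \<in> signed_measures I_borel"
    and eq: "moment_map u n \<mu> = moment_map u n \<nu>"
  shows "(\<lambda>A. \<mu> A - \<nu> A) \<in> moment_kernel u n"
proof -
  have "signed_integral I_borel (\<lambda>A. \<mu> A - \<nu> A) (u k) = 0" if k: "k \<le> n" for k
  proof -
    have "bounded (u k ` {-1..1})"
      using u[OF k] by (intro compact_imp_bounded compact_continuous_image) auto
    then obtain c where "\<forall>x\<in>{-1..1}. \<bar>u k x\<bar> \<le> c"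
      by (auto simp: bounded_iff)
    then have "signed_integral I_borel (\<lambda>A. \<mu> A - \<nu> A) (u k)
        = signed_integral I_borel \<mu> (u k) - signed_integral I_borel \<nu> (u k)"
      using assms u[OF k]
      by (intro signed_integral_diff borel_measurable_continuous_on_restrict)
        (auto simp: space_restrict_space)
    also have "\<dots> = 0"
      using fun_cong[OF eq, of k] k by (simp add: moment_map_def)
    finally show ?thesis .
  qed
  then show ?thesis
    using assms(2,3) by (auto simp: moment_kernel_def moment_map_def signed_measures_diff)
qed

text \<open>Off \<open>S\<close> the measures \<open>\<mu>\<close> and \<open>\<nu>\<close> agree
  because \<open>\<sigma>\<close> vanishes there; on \<open>S\<close> the triangle inequality
  applies. Without subtraction, the inequality serves the strict and the weak case alike: only the
  two restricted norms remain to be compared.\<close>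

lemma tv_norm_perturbation:
  assumes \<sigma>: "\<sigma> \<in> signed_measures M" and \<nu>: "\<nu> \<in> signed_measures M" and ne: "space M \<noteq> {}"
    and S: "S \<in> sets M" and conc: "\<And>A. A \<in> sets M \<Longrightarrow> A \<inter> S = {} \<Longrightarrow> \<sigma> A = 0"
  defines "\<mu> \<equiv> \<lambda>A. \<nu> A - \<sigma> A"
  shows "tv_norm M \<sigma> + tv_norm M (signed_restrict M \<mu> (space M - S))
    \<le> tv_norm M \<nu> + tv_norm M (signed_restrict M \<mu> S)"
proof -
  have \<mu>: "\<mu> \<in> signed_measures M"
    unfolding \<mu>_def using \<nu> \<sigma> by (rule signed_measures_diff)
  have "\<sigma> (A \<inter> (space M - S)) = 0" if "A \<in> sets M" for A
    using that S by (intro conc) auto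
  then have "signed_restrict M \<mu> (space M - S) = signed_restrict M \<nu> (space M - S)"
    by (simp add: fun_eq_iff signed_restrict_def \<mu>_def)
  \<comment> \<open>On measurable sets this holds because \<open>S\<close> carries
    \<open>\<sigma>\<close>; on all others both sides are 0 by convention.\<close>
  moreover have "\<sigma> = (\<lambda>A. signed_restrict M \<nu> S A - signed_restrict M \<mu> S A)"
  proof
    fix A
    show "\<sigma> A = signed_restrict M \<nu> S A - signed_restrict M \<mu> S A"
      using signed_measures_notin_sets[OF \<sigma>, of A] signed_measures_Int_Diff[OF \<sigma> _ S, of A]
        conc[of "A - S"] S
      by (auto simp: signed_restrict_def \<mu>_def)
  qed
  then have "tv_norm M \<sigma> \<le> tv_norm M (signed_restrict M \<nu> S) + tv_norm M (signed_restrict M \<mu> S)"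
    using tv_norm_diff_le[OF signed_restrict_signed_measures[OF \<nu> S]
        signed_restrict_signed_measures[OF \<mu> S] ne] by simp
  ultimately show ?thesis
    using tv_norm_restrict_add[OF \<nu> ne S] by simp
qed

theorem proposition4p1:
  fixes u :: "nat \<Rightarrow> real \<Rightarrow> real" and n :: nat
    and \<Upsilon> :: "(real set \<times> real set) set" and \<sigma> :: "real set \<Rightarrow> real"
  assumes "\<And>k. k \<le> n \<Longrightarrow> continuous_on {-1..1} (u k)"
    and "jordan_support_family \<Upsilon>"
    and "\<sigma> \<in> signed_measures I_borel"
    and "jordan_support I_borel \<sigma> \<in> \<Upsilon>"
  shows "(nullspace_property u n \<Upsilon> \<longrightarrow> minimal_extrapolations u n (moment_map u n \<sigma>) = {\<sigma>}) \<and>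
    (weak_nullspace_property u n \<Upsilon> \<longrightarrow> \<sigma> \<in> minimal_extrapolations u n (moment_map u n \<sigma>))"
proof -
  obtain Sp Sn where supp: "jordan_support I_borel \<sigma> = (Sp, Sn)"
    by fastforce
  define S where "S = Sp \<union> Sn"
  have \<Upsilon>: "(Sp, Sn) \<in> \<Upsilon>"
    using assms(4) supp by simp
  then have S: "finite S" "S \<subseteq> {-1..1}"
    using assms(2) by (auto simp: jordan_support_family_def S_def)
  then have SM: "S \<in> sets I_borel"
    by (simp add: sets_restrict_space_iff finite_imp_closed)
  have space: "space I_borel = {-1..1}" and ne: "space I_borel \<noteq> {}"
    by (auto simp: space_restrict_space)
  define tS where "tS \<mu> = tv_norm I_borel (signed_restrict I_borel \<mu> S)" for \<mu>
  define tC where "tC \<mu> = tv_norm I_borel (signed_restrict I_borel \<mu> ({-1..1} - S))" for \<mu>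
  have perturb: "tv_norm I_borel \<sigma> + tC (\<lambda>A. \<nu> A - \<sigma> A) \<le> tv_norm I_borel \<nu> + tS (\<lambda>A. \<nu> A - \<sigma> A)"
    if "\<nu> \<in> signed_measures I_borel" for \<nu>
    using tv_norm_perturbation[OF assms(3) that ne SM
        signed_measure_disjoint_jordan_support[OF assms(3) supp, folded S_def]]
    by (simp only: tS_def tC_def space)
  \<comment> \<open>Both nullspace properties speak of nonzero kernel elements only, hence the
    condition \<open>\<nu> \<noteq> \<sigma>\<close>. For \<open>\<nu> = \<sigma>\<close> the
    comparison of norms is trivial.\<close>
  have kernel: "(\<lambda>A. \<nu> A - \<sigma> A) \<in> moment_kernel u n \<and> (\<lambda>A. \<nu> A - \<sigma> A) \<noteq> (\<lambda>A. 0)"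
    if "\<nu> \<in> signed_measures I_borel" "moment_map u n \<nu> = moment_map u n \<sigma>" "\<nu> \<noteq> \<sigma>" for \<nu>
    using moment_map_diff[OF assms(1) that(1) assms(3) that(2)] that(3) by (auto simp: fun_eq_iff)
  have strict: "tv_norm I_borel \<sigma> < tv_norm I_borel \<nu>"
    if "nullspace_property u n \<Upsilon>" "\<nu> \<in> signed_measures I_borel"
      "moment_map u n \<nu> = moment_map u n \<sigma>" "\<nu> \<noteq> \<sigma>" for \<nu>
  proof -
    have "tS (\<lambda>A. \<nu> A - \<sigma> A) < tC (\<lambda>A. \<nu> A - \<sigma> A)"
      using that(1) kernel[OF that(2-)] \<Upsilon>
      by (auto simp: nullspace_property_def Let_def tS_def tC_def S_def)
    then show ?thesis
      using perturb[OF that(2)] by linarith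
  qed
  have weak: "tv_norm I_borel \<sigma> \<le> tv_norm I_borel \<nu>"
    if "weak_nullspace_property u n \<Upsilon>" "\<nu> \<in> signed_measures I_borel"
      "moment_map u n \<nu> = moment_map u n \<sigma>" "\<nu> \<noteq> \<sigma>" for \<nu>
  proof -
    have "tS (\<lambda>A. \<nu> A - \<sigma> A) \<le> tC (\<lambda>A. \<nu> A - \<sigma> A)"
      using that(1) kernel[OF that(2-)] \<Upsilon>
      by (auto simp: weak_nullspace_property_def Let_def tS_def tC_def S_def)
    then show ?thesis
      using perturb[OF that(2)] by linarith
  qed
  show ?thesis
  proof (intro conjI impI)
    assume np: "nullspace_property u n \<Upsilon>"
    show "minimal_extrapolations u n (moment_map u n \<sigma>) = {\<sigma>}"
    proof (intro equalityI subsetI)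
      fix \<nu> assume \<nu>: "\<nu> \<in> minimal_extrapolations u n (moment_map u n \<sigma>)"
      then have "tv_norm I_borel \<nu> \<le> tv_norm I_borel \<sigma>"
        using assms(3) by (auto simp: minimal_extrapolations_def)
      \<comment> \<open>A minimizer other than \<open>\<sigma>\<close> would have strictly larger
        norm than \<open>\<sigma>\<close>, which has the same moments.\<close>
      then show "\<nu> \<in> {\<sigma>}"
        using strict[OF np, of \<nu>] \<nu> by (fastforce simp: minimal_extrapolations_def)
    next
      fix \<nu> assume "\<nu> \<in> {\<sigma>}"
      then show "\<nu> \<in> minimal_extrapolations u n (moment_map u n \<sigma>)"
        using strict[OF np] assms(3) by (fastforce simp: minimal_extrapolations_def)
    qed
  next
    assume "weak_nullspace_property u n \<Upsilon>"
    then show "\<sigma> \<in> minimal_extrapolations u n (moment_map u n \<sigma>)"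
      using weak assms(3) by (fastforce simp: minimal_extrapolations_def)
  qed
qed

end
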